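(* The following group equality holds $H_n=L_{n-1}\times L_{n-1}^{x_n}\times L_{n-1}^{x_n^2}$.
   Context: Let $\mathcal{T}$ be the rooted $3$-ary tree whose vertices are words over $X=\{0,1,2\}$, and $\mathcal{T}_n$ its truncation at level $n$. Via sections, $\mathrm{Aut}(\mathcal{T}_n)\cong(\mathrm{Aut}(\mathcal{T}_{n-1})^3)\rtimes S_3$, and an element is written $(\sigma_0,\sigma_1,\sigma_2)\pi$ with $\sigma_i\in\mathrm{Aut}(\mathcal{T}_{n-1})$ and $\pi\in S_3$. $\mathrm{Aut}(\mathcal{T}_{n-1})$ is embedded in $\mathrm{Aut}(\mathcal{T}_n)$ by $\sigma\mapsto(\sigma,\mathrm{id},\mathrm{id})$. Define recursively $x_1=(0,1,2)$, $y_1=(0,1)$, $z_1=\mathrm{id}$ in $S_3=\mathrm{Aut}(\mathcal{T}_1)$, and for $n\ge2$: $x_n=(\mathrm{id},\mathrm{id},x_{n-1})(0,1,2)$, $y_n=(\mathrm{id},y_{n-1},x_{n-1})(0,1)$, $z_n=(y_{n-1},y_{n-1},x_{n-1})$. Let $L_0$ be trivial, $L_n=\langle x_n,z_n,L_{n-1}\rangle$, $M_n=\langle x_n,y_n,z_n,L_{n-1}\rangle$, and let $H_n=\langle L_{n-1}\rangle^{L_n}$ be the normal closure of $L_{n-1}$ in $L_n$. Here $L_{n-1}^{x_n}$ denotes the conjugate of $L_{n-1}$ by $x_n$. *)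

theory Defs
  imports
    "HOL-Algebra.Generated_Groups"
    "HOL-Library.Numeral_Type"
    "HOL-Combinatorics.Cycles"
begin

text \<open>The alphabet is the three-element type \<open>3\<close>, whose elements are \<open>0\<close>, \<open>1\<close>, \<open>2\<close>.\<close>

type_synonym word = "3 list"

definition tree_vertices :: "nat \<Rightarrow> word set" where
  "tree_vertices n = {w. length w \<le> n}"

definition tree_adj :: "word \<Rightarrow> word \<Rightarrow> bool" where
  "tree_adj u v \<longleftrightarrow> (\<exists>i. v = u @ [i] \<or> u = v @ [i])"

definition tree_auts :: "nat \<Rightarrow> (word \<Rightarrow> word) set" where
  "tree_auts n = {f. f permutes tree_vertices n \<and> f [] = [] \<and>
     (\<forall>u\<in>tree_vertices n. \<forall>v\<in>tree_vertices n. tree_adj (f u) (f v) \<longleftrightarrow> tree_adj u v)}"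

text \<open>Automorphisms act from the right: the product \<open>f g\<close> applies \<open>f\<close> first. With this
  convention \<open>(\<sigma>\<^sub>0, \<sigma>\<^sub>1, \<sigma>\<^sub>2)\<pi>\<close>, whose section at the letter \<open>i\<close> is \<open>\<sigma>\<^sub>i\<close>, is the product of
  \<open>(\<sigma>\<^sub>0, \<sigma>\<^sub>1, \<sigma>\<^sub>2)\<close> and \<open>\<pi>\<close>, and \<open>g\<^sup>h = h\<^sup>-\<^sup>1 g h\<close>.\<close>

definition AutT :: "nat \<Rightarrow> (word \<Rightarrow> word) monoid" where
  "AutT n = \<lparr>carrier = tree_auts n, monoid.mult = (\<lambda>f g. g \<circ> f), one = id\<rparr>"

fun component :: "'a \<times> 'a \<times> 'a \<Rightarrow> 3 \<Rightarrow> 'a" where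
  "component (a, b, c) i = (if i = 0 then a else if i = 1 then b else c)"

text \<open>\<open>wr n (\<sigma>\<^sub>0, \<sigma>\<^sub>1, \<sigma>\<^sub>2) \<pi>\<close> is the automorphism \<open>(\<sigma>\<^sub>0, \<sigma>\<^sub>1, \<sigma>\<^sub>2)\<pi>\<close> of the tree of height \<open>n\<close>,
  for \<open>\<sigma>\<^sub>i\<close> in \<open>tree_auts (n - 1)\<close>. Words that are not vertices are fixed, as required
  by \<open>permutes\<close>.\<close>

fun wr :: "nat \<Rightarrow> (word \<Rightarrow> word) \<times> (word \<Rightarrow> word) \<times> (word \<Rightarrow> word) \<Rightarrow> (3 \<Rightarrow> 3) \<Rightarrow> word \<Rightarrow> word" where
  "wr n s p [] = []"
| "wr n s p (i # w) = (if length (i # w) \<le> n then p i # component s i w else i # w)"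

abbreviation cyc012 :: "3 \<Rightarrow> 3" where
  "cyc012 \<equiv> cycle_of_list [0, 1, 2]"

abbreviation cyc01 :: "3 \<Rightarrow> 3" where
  "cyc01 \<equiv> cycle_of_list [0, 1]"

definition tree_embed :: "nat \<Rightarrow> (word \<Rightarrow> word) \<Rightarrow> word \<Rightarrow> word" where
  "tree_embed n s = wr n (s, id, id) id"

text \<open>The sequences start at index 1; the value at 0 is a dummy.\<close>

fun gen_x :: "nat \<Rightarrow> word \<Rightarrow> word" where
  "gen_x 0 = id"
| "gen_x (Suc 0) = wr 1 (id, id, id) cyc012"
| "gen_x (Suc (Suc n)) = wr (Suc (Suc n)) (id, id, gen_x (Suc n)) cyc012"

fun gen_y :: "nat \<Rightarrow> word \<Rightarrow> word" where
  "gen_y 0 = id"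
| "gen_y (Suc 0) = wr 1 (id, id, id) cyc01"
| "gen_y (Suc (Suc n)) = wr (Suc (Suc n)) (id, gen_y (Suc n), gen_x (Suc n)) cyc01"

fun gen_z :: "nat \<Rightarrow> word \<Rightarrow> word" where
  "gen_z 0 = id"
| "gen_z (Suc 0) = id"
| "gen_z (Suc (Suc n)) = wr (Suc (Suc n)) (gen_y (Suc n), gen_y (Suc n), gen_x (Suc n)) id"

fun grp_L :: "nat \<Rightarrow> (word \<Rightarrow> word) set" where
  "grp_L 0 = {id}"
| "grp_L (Suc n) =
     generate (AutT (Suc n)) ({gen_x (Suc n), gen_z (Suc n)} \<union> tree_embed (Suc n) ` grp_L n)"

definition normal_closure :: "('a, 'b) monoid_scheme \<Rightarrow> 'a set \<Rightarrow> 'a set" where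
  "normal_closure G S = \<Inter>{N. N \<lhd> G \<and> S \<subseteq> N}"

definition conj_set :: "('a, 'b) monoid_scheme \<Rightarrow> 'a set \<Rightarrow> 'a \<Rightarrow> 'a set" where
  "conj_set G A g = (\<lambda>a. inv\<^bsub>G\<^esub> g \<otimes>\<^bsub>G\<^esub> a \<otimes>\<^bsub>G\<^esub> g) ` A"

definition grp_H :: "nat \<Rightarrow> (word \<Rightarrow> word) set" where
  "grp_H n = normal_closure (AutT n\<lparr>carrier := grp_L n\<rparr>) (tree_embed n ` grp_L (n - 1))"

text \<open>The product set \<open>ABC\<close> of three subgroups is their internal direct product.\<close>

definition internal_direct3 :: "('a, 'b) monoid_scheme \<Rightarrow> 'a set \<Rightarrow> 'a set \<Rightarrow> 'a set \<Rightarrow> bool" where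
  "internal_direct3 G A B C \<longleftrightarrow>
     subgroup A G \<and> subgroup B G \<and> subgroup C G \<and>
     (\<lambda>(a, b, c). a \<otimes>\<^bsub>G\<^esub> b \<otimes>\<^bsub>G\<^esub> c) \<in>
       iso (G\<lparr>carrier := A\<rparr> \<times>\<times> G\<lparr>carrier := B\<rparr> \<times>\<times> G\<lparr>carrier := C\<rparr>)
           (G\<lparr>carrier := A <#>\<^bsub>G\<^esub> B <#>\<^bsub>G\<^esub> C\<rparr>)"

end

theory Submission
  imports Defs
begin

text \<open>
  Write \<open>L'\<close>, \<open>x'\<close>, \<open>y'\<close> for the objects one level down. Conjugation by
  \<open>x = (1, 1, x')(0 1 2)\<close> shifts the coordinates cyclically, so the product of the three
  conjugates of \<open>L'\<close> is the group \<open>K\<close> of all triples over \<open>L'\<close>. It lies in every normal subgroup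
  of \<open>L\<close> containing \<open>L'\<close>, and it is itself normal in \<open>L\<close> as soon as \<open>z = (y', y', x')\<close>
  normalises it, that is, as soon as \<open>y'\<close> normalises \<open>L'\<close>. The latter holds on
  every level: \<open>y\<close> commutes with \<open>z\<close>, conjugation by \<open>y\<close> acts on \<open>L'\<close> like conjugation by \<open>x\<close>, and
  \<open>x\<^sup>y x = (y'\<^sup>-\<^sup>1 x'\<^sup>2, y', 1)\<close> lies in \<open>z K\<close> because \<open>y'\<^sup>2 \<in> L'\<close>.
\<close>

section \<open>Conjugation and generated subgroups\<close>

context group
begin

text \<open>Turns a conjugate into an equation free of \<open>inv g\<close>, so that conjugates of
  tree automorphisms are found by multiplying \<open>wr\<close> forms.\<close>

lemma conj_eqI:
  assumes "g \<in> carrier G" "h \<in> carrier G" "k \<in> carrier G" "h \<otimes> g = g \<otimes> k"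
  shows "inv g \<otimes> h \<otimes> g = k"
  using assms by (simp add: m_assoc inv_solve_left')

lemma conj_mult:
  assumes "g \<in> carrier G" "h \<in> carrier G" "k \<in> carrier G"
  shows "inv g \<otimes> (h \<otimes> k) \<otimes> g = (inv g \<otimes> h \<otimes> g) \<otimes> (inv g \<otimes> k \<otimes> g)"
proof -
  have "g \<otimes> (inv g \<otimes> (k \<otimes> g)) = k \<otimes> g" using assms by (simp flip: m_assoc)
  then show ?thesis using assms by (simp add: m_assoc)
qed

text \<open>Conjugation by \<open>g\<close> respects products and inverses, so its values on
  \<open>S\<close> control its values on all words over \<open>S\<close>.\<close>

lemma conj_generate_closed:
  assumes S: "S \<subseteq> carrier G" and g: "g \<in> carrier G"
    and gen: "\<And>s. s \<in> S \<Longrightarrow> inv g \<otimes> s \<otimes> g \<in> generate G S"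
    and h: "h \<in> generate G S"
  shows "inv g \<otimes> h \<otimes> g \<in> generate G S"
  using h
proof induction
  case one
  show ?case using g by (simp add: generate.one)
next
  case (incl h)
  then show ?case using gen by blast
next
  case (inv h)
  then have "inv (inv g \<otimes> h \<otimes> g) \<in> generate G S"
    using gen generate_m_inv_closed S by blast
  moreover have "inv (inv g \<otimes> h \<otimes> g) = inv g \<otimes> inv h \<otimes> g"
    using inv S g by (auto simp: inv_mult_group m_assoc subset_iff)
  ultimately show ?case by simp
next
  case (eng h k)
  then show ?case
    using conj_mult[OF g, of h k] generate_in_carrier[OF S] generate.eng by metis
qed

text \<open>Conjugation by \<open>g\<close> is injective, hence permutes the finite set
  \<open>K\<close> once it maps \<open>K\<close> into itself; the inverse permutation is conjugation
  by \<open>inv g\<close>.\<close>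

lemma conj_stable_inverse:
  assumes fin: "finite K" and K: "K \<subseteq> carrier G" and g: "g \<in> carrier G"
    and stable: "\<And>k. k \<in> K \<Longrightarrow> inv g \<otimes> k \<otimes> g \<in> K"
    and k: "k \<in> K"
  shows "g \<otimes> k \<otimes> inv g \<in> K"
proof -
  have "inj_on (\<lambda>k. inv g \<otimes> k \<otimes> g) K"
    using K g by (auto intro!: inj_onI simp: subset_iff)
  then have "(\<lambda>k. inv g \<otimes> k \<otimes> g) ` K = K"
    using fin stable by (intro endo_inj_surj) auto
  then obtain h where h: "h \<in> K" "k = inv g \<otimes> h \<otimes> g" using k by auto
  then have "g \<otimes> k \<otimes> inv g = h"
    using K g by (auto simp: m_assoc subset_iff) (simp add: m_assoc[symmetric])
  then show ?thesis using h by simp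
qed

text \<open>In contrast to \<open>conj_generate_closed\<close>, the conjugating element runs through
  the generated group while \<open>K\<close> stays fixed. Inverses of generators are covered by the
  finiteness of \<open>K\<close>.\<close>

lemma conj_stable_generate:
  assumes fin: "finite K" and K: "K \<subseteq> carrier G" and S: "S \<subseteq> carrier G"
    and stable: "\<And>s k. s \<in> S \<Longrightarrow> k \<in> K \<Longrightarrow> inv s \<otimes> k \<otimes> s \<in> K"
    and g: "g \<in> generate G S" and k: "k \<in> K"
  shows "inv g \<otimes> k \<otimes> g \<in> K"
  using g k
proof (induction arbitrary: k)
  case one
  then show ?case using K by auto
next
  case (incl s)
  then show ?case using stable by blast
next
  case (inv s)
  then show ?case using conj_stable_inverse[OF fin K] stable S by (auto simp: subset_iff)
next
  case (eng g h)
  have "inv h \<otimes> (inv g \<otimes> k \<otimes> g) \<otimes> h \<in> K" using eng by blast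
  moreover have "inv h \<otimes> (inv g \<otimes> k \<otimes> g) \<otimes> h = inv (g \<otimes> h) \<otimes> k \<otimes> (g \<otimes> h)"
    using eng generate_in_carrier[OF S] K by (simp add: inv_mult_group m_assoc subset_iff)
  ultimately show ?case by simp
qed

lemma normal_in_generateI:
  assumes fin: "finite K" and K: "subgroup K G" "K \<subseteq> generate G S" and S: "S \<subseteq> carrier G"
    and stable: "\<And>s k. s \<in> S \<Longrightarrow> k \<in> K \<Longrightarrow> inv s \<otimes> k \<otimes> s \<in> K"
  shows "K \<lhd> G\<lparr>carrier := generate G S\<rparr>"
proof -
  have sub: "subgroup (generate G S) G" using S by (rule generate_is_subgroup)
  interpret H: group "G\<lparr>carrier := generate G S\<rparr>" using sub by (rule subgroup_imp_group)
  \<comment> \<open>The criterion \<open>normal_inv_iff\<close> has the inverse on the right, so the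
    stability lemma is applied to \<open>inv g\<close>.\<close>
  have "g \<otimes> k \<otimes> inv g \<in> K" if "g \<in> generate G S" "k \<in> K" for g k
    using conj_stable_generate[OF fin subgroup.subset[OF K(1)] S stable _ that(2), of "inv g"]
      that generate_m_inv_closed[OF S] generate_in_carrier[OF S] by auto
  then show ?thesis
    using sub K subgroup_incl by (auto simp: H.normal_inv_iff m_inv_consistent)
qed

end

section \<open>Automorphisms of the truncated tree\<close>

lemma UNIV_3: "(UNIV :: 3 set) = {0, 1, 2}"
proof -
  have "(i :: 3) = 0 \<or> i = 1 \<or> i = 2" for i
  proof (cases i)
    case (of_int z)
    \<comment> \<open>Elements of the numeral type are images of integers \<open>z\<close> with
      \<open>0 <= z\<close> and \<open>z < 3\<close>.\<close>
    then have "z = 0 \<or> z = 1 \<or> z = 2" by auto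
    with of_int show ?thesis by auto
  qed
  then show ?thesis by auto
qed

lemma two_3_neq [simp]: "(2 :: 3) \<noteq> 0" "(2 :: 3) \<noteq> 1" "(0 :: 3) \<noteq> 2" "(1 :: 3) \<noteq> 2"
proof -
  \<comment> \<open>A coincidence among the letters would leave fewer than three elements in the
    type.\<close>
  have "card {0, 1, 2 :: 3} = 3" by (simp flip: UNIV_3)
  then have "(2 :: 3) \<noteq> 0 \<and> (2 :: 3) \<noteq> 1"
    by (cases "(2 :: 3) = 0"; cases "(2 :: 3) = 1") simp_all
  then show "(2 :: 3) \<noteq> 0" "(2 :: 3) \<noteq> 1" "(0 :: 3) \<noteq> 2" "(1 :: 3) \<noteq> 2" by metis+
qed

lemma all_3: "(\<forall>i :: 3. P i) \<longleftrightarrow> P 0 \<and> P 1 \<and> P 2"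
  using UNIV_3 by (metis UNIV_I empty_iff insert_iff)

lemma cyc012_simps [simp]: "cyc012 0 = 1" "cyc012 1 = 2" "cyc012 2 = 0"
  by (simp_all add: transpose_def)

lemma cyc01_simps [simp]: "cyc01 0 = 1" "cyc01 1 = 0" "cyc01 2 = 2"
  by (simp_all add: transpose_def)

declare cycle_of_list.simps [simp del]

lemma bij_cyc: "bij cyc012" "bij cyc01"
  by (simp_all add: permutes_bij[OF cycle_permutes])

section \<open>The automorphism groups as finite groups\<close>

lemma finite_tree_vertices: "finite (tree_vertices n)"
  using finite_lists_length_le[of "UNIV :: 3 set" n] by (simp add: tree_vertices_def)

lemma carrier_AutT [simp]: "carrier (AutT n) = tree_auts n"
  and one_AutT: "\<one>\<^bsub>AutT n\<^esub> = id"
  and mult_AutT: "f \<otimes>\<^bsub>AutT n\<^esub> g = g \<circ> f"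
  by (simp_all add: AutT_def)

lemma finite_tree_auts: "finite (tree_auts n)"
  by (rule finite_subset[OF _ finite_permutations[OF finite_tree_vertices[of n]]])
    (auto simp: tree_auts_def)

lemma inv_in_tree_auts:
  assumes "f \<in> tree_auts n"
  shows "inv_into UNIV f \<in> tree_auts n"
proof -
  let ?g = "inv_into UNIV f"
  have f: "f permutes tree_vertices n" "f [] = []" using assms by (auto simp: tree_auts_def)
  have g: "?g permutes tree_vertices n" using f(1) by (rule permutes_inv)
  have "tree_adj (?g u) (?g v) \<longleftrightarrow> tree_adj u v"
    if "u \<in> tree_vertices n" "v \<in> tree_vertices n" for u v
  proof -
    \<comment> \<open>The adjacency condition is an equivalence, so reading it at the preimages
      yields it for the inverse.\<close>
    have "tree_adj (f (?g u)) (f (?g v)) \<longleftrightarrow> tree_adj (?g u) (?g v)"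
      using assms that permutes_in_image[OF g] by (auto simp: tree_auts_def)
    then show ?thesis using permutes_inverses(1)[OF f(1)] by simp
  qed
  moreover have "?g [] = []" using f permutes_inverses(2)[OF f(1), of "[]"] by simp
  ultimately show ?thesis using g by (auto simp: tree_auts_def)
qed

lemma group_AutT: "group (AutT n)"
proof (rule groupI)
  fix f g assume "f \<in> carrier (AutT n)" "g \<in> carrier (AutT n)"
  then show "f \<otimes>\<^bsub>AutT n\<^esub> g \<in> carrier (AutT n)"
    by (auto simp: mult_AutT tree_auts_def permutes_compose permutes_in_image)
next
  show "\<one>\<^bsub>AutT n\<^esub> \<in> carrier (AutT n)"
    by (auto simp: one_AutT tree_auts_def permutes_id)
next
  fix f assume f: "f \<in> carrier (AutT n)"
  then have "inv_into UNIV f \<otimes>\<^bsub>AutT n\<^esub> f = \<one>\<^bsub>AutT n\<^esub>"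
    by (auto simp: mult_AutT one_AutT tree_auts_def permutes_inv_o)
  then show "\<exists>g\<in>carrier (AutT n). g \<otimes>\<^bsub>AutT n\<^esub> f = \<one>\<^bsub>AutT n\<^esub>"
    using f inv_in_tree_auts by auto
qed (auto simp: mult_AutT one_AutT)

section \<open>Sections and the wreath recursion\<close>

lemma tree_adj_simps [simp]:
  "tree_adj (i # u) (j # v) \<longleftrightarrow> i = j \<and> tree_adj u v"
  "tree_adj [] (j # v) \<longleftrightarrow> v = []"
  "tree_adj (j # v) [] \<longleftrightarrow> v = []"
  "\<not> tree_adj [] []"
  by (auto simp: tree_adj_def)

lemma component_in_tree_auts:
  assumes "a \<in> tree_auts n" "b \<in> tree_auts n" "c \<in> tree_auts n"
  shows "component (a, b, c) i \<in> tree_auts n"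
  using assms by simp

text \<open>A permutation of the vertices cannot carry a word across the truncation level; this
  settles the length test in \<open>wr\<close>.\<close>

lemma tree_auts_length_le_iff: "f \<in> tree_auts n \<Longrightarrow> length (f w) \<le> n \<longleftrightarrow> length w \<le> n"
  using permutes_in_image[of f "tree_vertices n" w] by (auto simp: tree_auts_def tree_vertices_def)

lemma tree_auts_inj: "f \<in> tree_auts n \<Longrightarrow> inj f"
  by (auto simp: tree_auts_def permutes_inj)

lemma tree_auts_eq_Nil_iff: "f \<in> tree_auts n \<Longrightarrow> f w = [] \<longleftrightarrow> w = []"
  using injD[OF tree_auts_inj[of f n], of w "[]"] by (auto simp: tree_auts_def)

text \<open>Nonempty words are adjacent iff they share the first letter and have adjacent tails, so
  adjacency passes through \<open>p\<close> and the sections; at the root it matters that sections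
  fix the empty word. Bijectivity follows from injectivity by finiteness.\<close>

lemma wr_in_tree_auts:
  assumes abc: "a \<in> tree_auts n" "b \<in> tree_auts n" "c \<in> tree_auts n" and p: "bij p"
  shows "wr (Suc n) (a, b, c) p \<in> tree_auts (Suc n)"
proof -
  let ?f = "wr (Suc n) (a, b, c) p" and ?V = "tree_vertices (Suc n)"
  define s where "s = component (a, b, c)"
  have s: "s i \<in> tree_auts n" for i unfolding s_def using abc by (rule component_in_tree_auts)
  \<comment> \<open>Phrased through \<open>s\<close>, this replaces \<open>wr.simps(2)\<close> below
    and avoids a split over the three letters.\<close>
  have f: "?f (i # w) = (if length w \<le> n then p i # s i w else i # w)" for i w
    by (simp add: s_def)
  have p_eq: "p i = p j \<longleftrightarrow> i = j" for i j using p by (auto simp: bij_def inj_def)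
  have s_eq: "s i u = s i v \<longleftrightarrow> u = v" for i u v using tree_auts_inj[OF s] by (auto dest: injD)
  have V: "i # w \<in> ?V \<longleftrightarrow> length w \<le> n" for i w by (simp add: tree_vertices_def)
  have img: "?f u \<in> ?V" if "u \<in> ?V" for u
    using that by (cases u) (auto simp: f V tree_auts_length_le_iff[OF s] simp del: wr.simps(2))
  have inj: "inj_on ?f ?V"
  proof (rule inj_onI)
    fix u v assume "u \<in> ?V" "v \<in> ?V" "?f u = ?f v"
    then show "u = v"
      by (cases u; cases v) (auto simp: f V p_eq s_eq simp del: wr.simps(2))
  qed
  have adj: "tree_adj (?f u) (?f v) \<longleftrightarrow> tree_adj u v" if "u \<in> ?V" "v \<in> ?V" for u v
  proof -
    have "tree_adj (s i w) (s i w') \<longleftrightarrow> tree_adj w w'" if "length w \<le> n" "length w' \<le> n" for i w w'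
      using s[of i] that by (auto simp: tree_auts_def tree_vertices_def)
    with that show ?thesis
      by (cases u; cases v)
        (auto simp: f V p_eq tree_auts_eq_Nil_iff[OF s] simp del: wr.simps(2))
  qed
  have "?f ` ?V = ?V" using finite_tree_vertices img inj by (intro endo_inj_surj) auto
  then have "bij_betw ?f ?V ?V" using inj by (simp add: bij_betw_def)
  moreover have "?f u = u" if "u \<notin> ?V" for u
    using that by (cases u) (auto simp: f V simp del: wr.simps(2))
  ultimately have "?f permutes ?V" by (rule bij_imp_permutes)
  then show ?thesis using adj by (auto simp: tree_auts_def)
qed

text \<open>In a right action the letter \<open>i\<close> reaches the second factor as
  \<open>p i\<close>, which selects the section there. The assumptions on the first factor make the
  length tests of both factors agree.\<close>

lemma wr_mult:
  assumes "a \<in> tree_auts n" "b \<in> tree_auts n" "c \<in> tree_auts n"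
  shows "wr (Suc n) (a, b, c) p \<otimes>\<^bsub>AutT (Suc n)\<^esub> wr (Suc n) t q =
    wr (Suc n) (a \<otimes>\<^bsub>AutT n\<^esub> component t (p 0), b \<otimes>\<^bsub>AutT n\<^esub> component t (p 1),
      c \<otimes>\<^bsub>AutT n\<^esub> component t (p 2)) (q \<circ> p)"
proof
  fix w
  show "(wr (Suc n) (a, b, c) p \<otimes>\<^bsub>AutT (Suc n)\<^esub> wr (Suc n) t q) w =
    wr (Suc n) (a \<otimes>\<^bsub>AutT n\<^esub> component t (p 0), b \<otimes>\<^bsub>AutT n\<^esub> component t (p 1),
      c \<otimes>\<^bsub>AutT n\<^esub> component t (p 2)) (q \<circ> p) w"
  proof (cases w)
    case (Cons i u)
    have "i = 0 \<or> i = 1 \<or> i = 2" using UNIV_3 by auto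
    then show ?thesis
      using Cons assms by (auto simp: mult_AutT tree_auts_length_le_iff)
  qed (simp add: mult_AutT)
qed

lemma wr_id: "wr (Suc n) (id, id, id) id = id"
proof
  show "wr (Suc n) (id, id, id) id w = id w" for w by (cases w) auto
qed

text \<open>With the dummy values at \<open>0\<close>, the recursions hold from level \<open>0\<close> on, so level \<open>1\<close>
  needs no separate treatment.\<close>

lemma gen_x_Suc: "gen_x (Suc n) = wr (Suc n) (id, id, gen_x n) cyc012"
  by (cases n) simp_all

lemma gen_y_Suc: "gen_y (Suc n) = wr (Suc n) (id, gen_y n, gen_x n) cyc01"
  by (cases n) simp_all

lemma gen_z_Suc: "gen_z (Suc n) = wr (Suc n) (gen_y n, gen_y n, gen_x n) id"
  by (cases n) (simp_all add: wr_id[of 0, simplified])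

declare gen_x.simps(2,3) [simp del] gen_y.simps(2,3) [simp del] gen_z.simps(2,3) [simp del]
  grp_L.simps(2) [simp del]

lemma id_in_tree_auts: "id \<in> tree_auts n"
  using group.is_monoid[OF group_AutT[of n]] monoid.one_closed by (fastforce simp: one_AutT)

lemma gens_in_tree_auts:
  "gen_x n \<in> tree_auts n" "gen_y n \<in> tree_auts n" "gen_z n \<in> tree_auts n"
proof -
  have x: "gen_x n \<in> tree_auts n" for n
  proof (induction n)
    case 0
    show ?case using id_in_tree_auts[of 0] by (simp add: id_def)
  next
    case (Suc n)
    then show ?case unfolding gen_x_Suc by (intro wr_in_tree_auts id_in_tree_auts bij_cyc)
  qed
  have y: "gen_y n \<in> tree_auts n" for n
  proof (induction n)
    case 0
    show ?case using id_in_tree_auts[of 0] by (simp add: id_def)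
  next
    case (Suc n)
    with x show ?case unfolding gen_y_Suc by (intro wr_in_tree_auts id_in_tree_auts bij_cyc)
  qed
  have "gen_z n \<in> tree_auts n"
  proof (cases n)
    case 0
    then show ?thesis using id_in_tree_auts[of 0] by (simp add: id_def)
  next
    case (Suc m)
    show ?thesis unfolding Suc gen_z_Suc by (intro wr_in_tree_auts x y bij_id)
  qed
  with x y show "gen_x n \<in> tree_auts n" "gen_y n \<in> tree_auts n" "gen_z n \<in> tree_auts n" by auto
qed

section \<open>Triples over the group one level down\<close>

text \<open>Stated for arbitrary functions, since the product is composition; simplification then
  meets no membership conditions.\<close>

lemma AutT_mult_id [simp]: "f \<otimes>\<^bsub>AutT n\<^esub> id = f" "id \<otimes>\<^bsub>AutT n\<^esub> f = f"
  by (simp_all add: mult_AutT)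

lemma inv_AutT_closed [simp]: "f \<in> tree_auts n \<Longrightarrow> inv\<^bsub>AutT n\<^esub> f \<in> tree_auts n"
  using group.inv_closed[OF group_AutT[of n], of f] by simp

lemma mult_AutT_closed [simp]:
  "f \<in> tree_auts n \<Longrightarrow> g \<in> tree_auts n \<Longrightarrow> f \<otimes>\<^bsub>AutT n\<^esub> g \<in> tree_auts n"
  using monoid.m_closed[OF group.is_monoid[OF group_AutT[of n]], of f g] by simp

text \<open>The transposition inverts the 3-cycle. The first identity gives the root permutation of
  \<open>x y x\<close>, the second that of \<open>y^2\<close>.\<close>

lemma cyc_comp:
  "cyc012 \<circ> cyc01 \<circ> cyc012 = cyc01" "cyc01 \<circ> cyc01 = id"
  by (simp_all add: fun_eq_iff all_3)

lemma wr_eq_iff: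
  assumes "a \<in> tree_auts n" "b \<in> tree_auts n" "c \<in> tree_auts n"
    "a' \<in> tree_auts n" "b' \<in> tree_auts n" "c' \<in> tree_auts n"
  shows "wr (Suc n) (a, b, c) p = wr (Suc n) (a', b', c') p \<longleftrightarrow> a = a' \<and> b = b' \<and> c = c'"
proof
  assume eq: "wr (Suc n) (a, b, c) p = wr (Suc n) (a', b', c') p"
  have "component (a, b, c) i = component (a', b', c') i" for i
  proof
    fix w
    have "component (a, b, c) i \<in> tree_auts n" "component (a', b', c') i \<in> tree_auts n"
      using assms by simp_all
    \<comment> \<open>\<open>wr\<close> reveals a section only on words of length at most
      \<open>n\<close>; on longer words both sections are the identity.\<close>
    then have "w \<notin> tree_vertices n \<Longrightarrow> component (a, b, c) i w = component (a', b', c') i w"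
      unfolding tree_auts_def by (metis (no_types, lifting) mem_Collect_eq permutes_not_in)
    moreover have "length w \<le> n \<Longrightarrow> component (a, b, c) i w = component (a', b', c') i w"
      using fun_cong[OF eq, of "i # w"] by simp
    ultimately show "component (a, b, c) i w = component (a', b', c') i w"
      unfolding tree_vertices_def by blast
  qed
  from this[of 0] this[of 1] this[of 2] show "a = a' \<and> b = b' \<and> c = c'" by simp
qed auto

text \<open>The group \<open>K\<close>, indexed by the level of its coordinates:
  \<open>triples n\<close> consists of automorphisms of the tree of height
  \<open>n + 1\<close>.\<close>

definition triples :: "nat \<Rightarrow> (word \<Rightarrow> word) set" where
  "triples n = {wr (Suc n) (a, b, c) id | a b c. a \<in> grp_L n \<and> b \<in> grp_L n \<and> c \<in> grp_L n}"

lemma triplesI: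
  "a \<in> grp_L n \<Longrightarrow> b \<in> grp_L n \<Longrightarrow> c \<in> grp_L n \<Longrightarrow> wr (Suc n) (a, b, c) id \<in> triples n"
  unfolding triples_def by blast

lemma tree_embed_in_tree_auts: "a \<in> tree_auts n \<Longrightarrow> tree_embed (Suc n) a \<in> tree_auts (Suc n)"
  unfolding tree_embed_def by (intro wr_in_tree_auts id_in_tree_auts bij_id)

lemma grp_L_subgroup: "subgroup (grp_L n) (AutT n)"
proof (induction n)
  case 0
  show ?case using group.triv_subgroup[OF group_AutT[of 0]] by (simp add: one_AutT)
next
  case (Suc n)
  then have "tree_embed (Suc n) ` grp_L n \<subseteq> carrier (AutT (Suc n))"
    using tree_embed_in_tree_auts subgroup.subset by fastforce
  then show ?case
    unfolding grp_L.simps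
    by (intro group.generate_is_subgroup[OF group_AutT]) (simp add: gens_in_tree_auts)
qed

lemma grp_L_in_tree_auts: "a \<in> grp_L n \<Longrightarrow> a \<in> tree_auts n"
  using subgroup.subset[OF grp_L_subgroup] by auto

lemma grp_L_generators:
  "{gen_x (Suc n), gen_z (Suc n)} \<union> tree_embed (Suc n) ` grp_L n \<subseteq> carrier (AutT (Suc n))"
  using gens_in_tree_auts[of "Suc n"] tree_embed_in_tree_auts grp_L_in_tree_auts by auto

lemma id_in_grp_L: "id \<in> grp_L n"
  using subgroup.one_closed[OF grp_L_subgroup] by (simp add: one_AutT)

text \<open>At level \<open>0\<close> the dummy generator is \<open>id\<close>, which lies in the
  trivial group, so every level is covered; the same holds for \<open>gen_z\<close>.\<close>

lemma gen_x_in_grp_L: "gen_x n \<in> grp_L n"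
  by (cases n) (auto intro: generate.incl simp: grp_L.simps(2))

lemma gen_z_in_grp_L: "gen_z n \<in> grp_L n"
  by (cases n) (auto intro: generate.incl simp: grp_L.simps(2))

lemma gen_x_square_in_grp_L: "gen_x n [^]\<^bsub>AutT n\<^esub> (2 :: nat) \<in> grp_L n"
proof -
  interpret G: group "AutT n" by (rule group_AutT)
  show ?thesis
    using gen_x_in_grp_L[of n] subgroup.m_closed[OF grp_L_subgroup] gens_in_tree_auts(1)[of n]
    by (simp add: numeral_2_eq_2)
qed

text \<open>\<open>x\<close> pushes each coordinate to the next letter; only the one that wraps from
  \<open>2\<close> to \<open>0\<close> passes through the section \<open>x'\<close> and is
  conjugated by it.\<close>

lemma conj_triple_x:
  assumes "a \<in> tree_auts n" "b \<in> tree_auts n" "c \<in> tree_auts n"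
  shows "inv\<^bsub>AutT (Suc n)\<^esub> gen_x (Suc n) \<otimes>\<^bsub>AutT (Suc n)\<^esub> wr (Suc n) (a, b, c) id
      \<otimes>\<^bsub>AutT (Suc n)\<^esub> gen_x (Suc n)
    = wr (Suc n) (inv\<^bsub>AutT n\<^esub> gen_x n \<otimes>\<^bsub>AutT n\<^esub> c \<otimes>\<^bsub>AutT n\<^esub> gen_x n, a, b) id"
proof -
  interpret G': group "AutT n" by (rule group_AutT)
  interpret G: group "AutT (Suc n)" by (rule group_AutT)
  note x = gens_in_tree_auts(1)[of n]
  have "wr (Suc n) (a, b, c) id \<otimes>\<^bsub>AutT (Suc n)\<^esub> gen_x (Suc n) = gen_x (Suc n) \<otimes>\<^bsub>AutT (Suc n)\<^esub>
      wr (Suc n) (inv\<^bsub>AutT n\<^esub> gen_x n \<otimes>\<^bsub>AutT n\<^esub> c \<otimes>\<^bsub>AutT n\<^esub> gen_x n, a, b) id"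
    unfolding gen_x_Suc using assms x
    by (simp add: wr_mult id_in_tree_auts flip: G'.m_assoc)
  then show ?thesis
    using assms x gens_in_tree_auts(1)[of "Suc n"] by (intro G.conj_eqI) (simp_all add: wr_in_tree_auts)
qed

text \<open>The root permutation of \<open>z\<close> is trivial, so each coordinate is conjugated by
  the section of \<open>z\<close> at its own letter.\<close>

lemma conj_triple_z:
  assumes "a \<in> tree_auts n" "b \<in> tree_auts n" "c \<in> tree_auts n"
  shows "inv\<^bsub>AutT (Suc n)\<^esub> gen_z (Suc n) \<otimes>\<^bsub>AutT (Suc n)\<^esub> wr (Suc n) (a, b, c) id
      \<otimes>\<^bsub>AutT (Suc n)\<^esub> gen_z (Suc n)
    = wr (Suc n) (inv\<^bsub>AutT n\<^esub> gen_y n \<otimes>\<^bsub>AutT n\<^esub> a \<otimes>\<^bsub>AutT n\<^esub> gen_y n,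
        inv\<^bsub>AutT n\<^esub> gen_y n \<otimes>\<^bsub>AutT n\<^esub> b \<otimes>\<^bsub>AutT n\<^esub> gen_y n,
        inv\<^bsub>AutT n\<^esub> gen_x n \<otimes>\<^bsub>AutT n\<^esub> c \<otimes>\<^bsub>AutT n\<^esub> gen_x n) id"
  (is "_ = ?k")
proof -
  interpret G': group "AutT n" by (rule group_AutT)
  interpret G: group "AutT (Suc n)" by (rule group_AutT)
  note xy = gens_in_tree_auts(1,2)[of n]
  have "wr (Suc n) (a, b, c) id \<otimes>\<^bsub>AutT (Suc n)\<^esub> gen_z (Suc n) =
      gen_z (Suc n) \<otimes>\<^bsub>AutT (Suc n)\<^esub> ?k"
    unfolding gen_z_Suc using assms xy
    by (simp add: wr_mult id_in_tree_auts flip: G'.m_assoc)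
  then show ?thesis
    using assms xy gens_in_tree_auts(3)[of "Suc n"] by (intro G.conj_eqI) (simp_all add: wr_in_tree_auts)
qed

lemma triples_mult:
  assumes "a \<in> tree_auts n" "b \<in> tree_auts n" "c \<in> tree_auts n"
  shows "wr (Suc n) (a, b, c) id \<otimes>\<^bsub>AutT (Suc n)\<^esub> wr (Suc n) (a', b', c') id =
    wr (Suc n) (a \<otimes>\<^bsub>AutT n\<^esub> a', b \<otimes>\<^bsub>AutT n\<^esub> b', c \<otimes>\<^bsub>AutT n\<^esub> c') id"
  using assms by (simp add: wr_mult)

lemma triples_inv:
  assumes "a \<in> tree_auts n" "b \<in> tree_auts n" "c \<in> tree_auts n"
  shows "inv\<^bsub>AutT (Suc n)\<^esub> wr (Suc n) (a, b, c) id =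
    wr (Suc n) (inv\<^bsub>AutT n\<^esub> a, inv\<^bsub>AutT n\<^esub> b, inv\<^bsub>AutT n\<^esub> c) id"
proof -
  interpret G': group "AutT n" by (rule group_AutT)
  interpret G: group "AutT (Suc n)" by (rule group_AutT)
  show ?thesis
    using assms G'.l_inv
    by (intro G.inv_equality) (simp_all add: triples_mult one_AutT wr_id wr_in_tree_auts)
qed

text \<open>Three separate subgroups are allowed so that the result covers both
  \<open>triples n\<close> and the three coordinate axes, where two of them are trivial.\<close>

lemma subgroup_wr_triples:
  assumes "subgroup A (AutT n)" "subgroup B (AutT n)" "subgroup C (AutT n)"
  shows "subgroup {wr (Suc n) (a, b, c) id | a b c. a \<in> A \<and> b \<in> B \<and> c \<in> C} (AutT (Suc n))"
proof -
  interpret G: group "AutT (Suc n)" by (rule group_AutT)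
  have carr: "a \<in> tree_auts n" if "a \<in> A \<or> a \<in> B \<or> a \<in> C" for a
    using that assms subgroup.subset by fastforce
  show ?thesis
  proof (rule G.subgroupI)
    show "{wr (Suc n) (a, b, c) id | a b c. a \<in> A \<and> b \<in> B \<and> c \<in> C} \<noteq> {}"
      using assms[THEN subgroup.one_closed] by auto
  next
    fix g assume "g \<in> {wr (Suc n) (a, b, c) id | a b c. a \<in> A \<and> b \<in> B \<and> c \<in> C}"
    then obtain a b c where g: "g = wr (Suc n) (a, b, c) id" "a \<in> A" "b \<in> B" "c \<in> C" by auto
    have "inv\<^bsub>AutT (Suc n)\<^esub> g = wr (Suc n) (inv\<^bsub>AutT n\<^esub> a, inv\<^bsub>AutT n\<^esub> b, inv\<^bsub>AutT n\<^esub> c) id"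
      unfolding g(1) using g carr by (intro triples_inv) auto
    then show "inv\<^bsub>AutT (Suc n)\<^esub> g \<in> {wr (Suc n) (a, b, c) id | a b c. a \<in> A \<and> b \<in> B \<and> c \<in> C}"
      using g assms[THEN subgroup.m_inv_closed] by blast
    fix h assume "h \<in> {wr (Suc n) (a, b, c) id | a b c. a \<in> A \<and> b \<in> B \<and> c \<in> C}"
    then obtain a' b' c' where h: "h = wr (Suc n) (a', b', c') id" "a' \<in> A" "b' \<in> B" "c' \<in> C"
      by auto
    have "g \<otimes>\<^bsub>AutT (Suc n)\<^esub> h =
        wr (Suc n) (a \<otimes>\<^bsub>AutT n\<^esub> a', b \<otimes>\<^bsub>AutT n\<^esub> b', c \<otimes>\<^bsub>AutT n\<^esub> c') id"
      unfolding g(1) h(1) using g carr by (intro triples_mult) auto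
    then show "g \<otimes>\<^bsub>AutT (Suc n)\<^esub> h \<in> {wr (Suc n) (a, b, c) id | a b c. a \<in> A \<and> b \<in> B \<and> c \<in> C}"
      using g h assms[THEN subgroup.m_closed] by blast
  qed (use carr in \<open>auto intro!: wr_in_tree_auts\<close>)
qed

lemma subgroup_triples: "subgroup (triples n) (AutT (Suc n))"
  unfolding triples_def by (intro subgroup_wr_triples grp_L_subgroup)

text \<open>Two shifts take coordinate \<open>0\<close> to coordinate \<open>2\<close>. The
  coordinate that wraps around is \<open>id\<close> each time, so no conjugation by
  \<open>x'\<close> remains.\<close>

lemma conj_set_embed:
  "conj_set (AutT (Suc n)) (tree_embed (Suc n) ` grp_L n) (gen_x (Suc n)) =
    (\<lambda>b. wr (Suc n) (id, b, id) id) ` grp_L n" (is ?B)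
  "conj_set (AutT (Suc n)) (tree_embed (Suc n) ` grp_L n)
      (gen_x (Suc n) [^]\<^bsub>AutT (Suc n)\<^esub> (2 :: nat)) =
    (\<lambda>c. wr (Suc n) (id, id, c) id) ` grp_L n" (is ?C)
proof -
  interpret G': group "AutT n" by (rule group_AutT)
  interpret G: group "AutT (Suc n)" by (rule group_AutT)
  let ?x = "gen_x (Suc n)"
  note x = gens_in_tree_auts(1)
  have id_conj: "inv\<^bsub>AutT n\<^esub> gen_x n \<otimes>\<^bsub>AutT n\<^esub> gen_x n = id"
    using x G'.l_inv by (simp add: one_AutT)
  have 1: "inv\<^bsub>AutT (Suc n)\<^esub> ?x \<otimes>\<^bsub>AutT (Suc n)\<^esub> wr (Suc n) (a, id, id) id \<otimes>\<^bsub>AutT (Suc n)\<^esub> ?x =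
      wr (Suc n) (id, a, id) id" if "a \<in> grp_L n" for a
    using conj_triple_x[of a n id id] that by (simp add: id_in_tree_auts grp_L_in_tree_auts id_conj)
  have 2: "inv\<^bsub>AutT (Suc n)\<^esub> ?x \<otimes>\<^bsub>AutT (Suc n)\<^esub> wr (Suc n) (id, a, id) id \<otimes>\<^bsub>AutT (Suc n)\<^esub> ?x =
      wr (Suc n) (id, id, a) id" if "a \<in> grp_L n" for a
    using conj_triple_x[of id n a id] that by (simp add: id_in_tree_auts grp_L_in_tree_auts id_conj)
  show ?B
    unfolding conj_set_def image_image tree_embed_def using 1 by (intro image_cong) simp_all
  \<comment> \<open>Conjugation by \<open>x^2\<close> is conjugation by \<open>x\<close> twice, to
    which \<open>1\<close> and then \<open>2\<close> apply.\<close>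
  have "inv\<^bsub>AutT (Suc n)\<^esub> (?x [^]\<^bsub>AutT (Suc n)\<^esub> (2 :: nat)) \<otimes>\<^bsub>AutT (Suc n)\<^esub>
      wr (Suc n) (a, id, id) id \<otimes>\<^bsub>AutT (Suc n)\<^esub> (?x [^]\<^bsub>AutT (Suc n)\<^esub> (2 :: nat)) =
    inv\<^bsub>AutT (Suc n)\<^esub> ?x \<otimes>\<^bsub>AutT (Suc n)\<^esub> (inv\<^bsub>AutT (Suc n)\<^esub> ?x \<otimes>\<^bsub>AutT (Suc n)\<^esub>
      wr (Suc n) (a, id, id) id \<otimes>\<^bsub>AutT (Suc n)\<^esub> ?x) \<otimes>\<^bsub>AutT (Suc n)\<^esub> ?x"
    if "a \<in> grp_L n" for a
    using that x[of "Suc n"] wr_in_tree_auts[of a n id id id]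
    by (simp add: numeral_2_eq_2 G.inv_mult_group G.m_assoc id_in_tree_auts grp_L_in_tree_auts)
  with 1 2 show ?C
    unfolding conj_set_def image_image tree_embed_def by (intro image_cong) simp_all
qed

text \<open>A triple is the product of its three axis parts, and these are conjugates of embedded
  elements by \<open>1\<close>, \<open>x\<close> and \<open>x^2\<close>, all taken inside
  \<open>L\<close>.\<close>

lemma triples_subset_grp_L: "triples n \<subseteq> grp_L (Suc n)"
proof
  fix g assume "g \<in> triples n"
  then obtain a b c where g: "g = wr (Suc n) (a, b, c) id" "a \<in> grp_L n" "b \<in> grp_L n" "c \<in> grp_L n"
    by (auto simp: triples_def)
  interpret G: group "AutT (Suc n)" by (rule group_AutT)
  interpret L: subgroup "grp_L (Suc n)" "AutT (Suc n)" by (rule grp_L_subgroup)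
  let ?x = "gen_x (Suc n)"
  have embed: "tree_embed (Suc n) d \<in> grp_L (Suc n)" if "d \<in> grp_L n" for d
    using that by (auto intro: generate.incl simp: grp_L.simps(2))
  have conj: "conj_set (AutT (Suc n)) (tree_embed (Suc n) ` grp_L n) h \<subseteq> grp_L (Suc n)"
    if "h \<in> grp_L (Suc n)" for h
    unfolding conj_set_def using that embed by (blast intro: L.m_closed L.m_inv_closed)
  have x: "?x \<in> grp_L (Suc n)" by (rule gen_x_in_grp_L)
  from conj[OF x] conj[OF gen_x_square_in_grp_L] g embed[of a]
  have "wr (Suc n) (a, id, id) id \<in> grp_L (Suc n)" "wr (Suc n) (id, b, id) id \<in> grp_L (Suc n)"
    "wr (Suc n) (id, id, c) id \<in> grp_L (Suc n)"
    unfolding conj_set_embed tree_embed_def by blast+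
  then have "wr (Suc n) (a, id, id) id \<otimes>\<^bsub>AutT (Suc n)\<^esub> wr (Suc n) (id, b, id) id
      \<otimes>\<^bsub>AutT (Suc n)\<^esub> wr (Suc n) (id, id, c) id \<in> grp_L (Suc n)"
    by (intro L.m_closed)
  then show "g \<in> grp_L (Suc n)"
    using g by (simp add: triples_mult id_in_tree_auts grp_L_in_tree_auts)
qed

section \<open>Normality\<close>

text \<open>\<open>y^2 = (y', y', x'^2)\<close> differs from \<open>z\<close> only by the factor
  \<open>(1, 1, x')\<close>, a triple over \<open>L'\<close>.\<close>

lemma gen_y_square: "gen_y n \<otimes>\<^bsub>AutT n\<^esub> gen_y n \<in> grp_L n"
proof (cases n)
  case 0
  then show ?thesis by simp
next
  case (Suc m)
  interpret L: subgroup "grp_L (Suc m)" "AutT (Suc m)" by (rule grp_L_subgroup)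
  have "gen_y (Suc m) \<otimes>\<^bsub>AutT (Suc m)\<^esub> gen_y (Suc m) =
      gen_z (Suc m) \<otimes>\<^bsub>AutT (Suc m)\<^esub> wr (Suc m) (id, id, gen_x m) id"
    unfolding gen_y_Suc gen_z_Suc
    by (simp add: wr_mult gens_in_tree_auts id_in_tree_auts cyc_comp)
  moreover have "wr (Suc m) (id, id, gen_x m) id \<in> grp_L (Suc m)"
    using triples_subset_grp_L gen_x_in_grp_L id_in_grp_L unfolding triples_def by blast
  ultimately show ?thesis
    unfolding Suc using gen_z_in_grp_L L.m_closed by simp
qed

text \<open>The conjugate equals \<open>z k x^-1\<close> for a triple \<open>k\<close> over
  \<open>L'\<close>. This is verified as \<open>x y x = y z k\<close>, which contains no inverse of
  \<open>x\<close> or \<open>y\<close> and can be compared section by section.\<close>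

lemma gen_y_conj_gen_x:
  "inv\<^bsub>AutT (Suc n)\<^esub> gen_y (Suc n) \<otimes>\<^bsub>AutT (Suc n)\<^esub> gen_x (Suc n) \<otimes>\<^bsub>AutT (Suc n)\<^esub> gen_y (Suc n)
    \<in> grp_L (Suc n)"
proof -
  interpret G': group "AutT n" by (rule group_AutT)
  interpret G: group "AutT (Suc n)" by (rule group_AutT)
  interpret L': subgroup "grp_L n" "AutT n" by (rule grp_L_subgroup)
  interpret L: subgroup "grp_L (Suc n)" "AutT (Suc n)" by (rule grp_L_subgroup)
  let ?x = "gen_x (Suc n)" and ?y = "gen_y (Suc n)" and ?z = "gen_z (Suc n)"
  let ?x' = "gen_x n" and ?y' = "gen_y n"
  \<comment> \<open>\<open>u = y'^-2 x'^2\<close> is chosen so that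
    \<open>z k = (y'^-1 x'^2, y', 1)\<close>. It lies in \<open>L'\<close> because
    \<open>y'^2\<close> does, although \<open>y'\<close> itself is not assumed to.\<close>
  let ?u = "inv\<^bsub>AutT n\<^esub> (?y' \<otimes>\<^bsub>AutT n\<^esub> ?y') \<otimes>\<^bsub>AutT n\<^esub> (?x' \<otimes>\<^bsub>AutT n\<^esub> ?x')"
  let ?k = "wr (Suc n) (?u, id, inv\<^bsub>AutT n\<^esub> ?x') id"
  note gens = gens_in_tree_auts[of n] gens_in_tree_auts[of "Suc n"]
  have "?u \<in> grp_L n" "inv\<^bsub>AutT n\<^esub> ?x' \<in> grp_L n"
    using gen_y_square gen_x_in_grp_L by (auto intro!: L'.m_closed L'.m_inv_closed)
  then have "?k \<in> triples n" using id_in_grp_L unfolding triples_def by blast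
  then have k: "?k \<in> grp_L (Suc n)" using triples_subset_grp_L by blast
  then have kc: "?k \<in> tree_auts (Suc n)" by (rule grp_L_in_tree_auts)
  \<comment> \<open>Both \<open>x y x\<close> and \<open>y z k\<close> should be
    \<open>(y', x'^2, x')(0 1)\<close>; this identity and the next match the sections at the letters
    \<open>1\<close> and \<open>2\<close>.\<close>
  have "?y' \<otimes>\<^bsub>AutT n\<^esub> (?y' \<otimes>\<^bsub>AutT n\<^esub> ?u) = ?x' \<otimes>\<^bsub>AutT n\<^esub> ?x'"
    using gens by (simp add: G'.inv_mult_group G'.inv_solve_left' flip: G'.m_assoc)
  moreover have "?x' \<otimes>\<^bsub>AutT n\<^esub> (?x' \<otimes>\<^bsub>AutT n\<^esub> inv\<^bsub>AutT n\<^esub> ?x') = ?x'"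
    using gens G'.r_inv by (simp add: one_AutT)
  ultimately have "?x \<otimes>\<^bsub>AutT (Suc n)\<^esub> (?y \<otimes>\<^bsub>AutT (Suc n)\<^esub> ?x) =
      ?y \<otimes>\<^bsub>AutT (Suc n)\<^esub> (?z \<otimes>\<^bsub>AutT (Suc n)\<^esub> ?k)"
    unfolding gen_x_Suc gen_y_Suc gen_z_Suc using gens
    by (simp add: wr_mult id_in_tree_auts cyc_comp)
  then have "?x \<otimes>\<^bsub>AutT (Suc n)\<^esub> ?y =
      ?y \<otimes>\<^bsub>AutT (Suc n)\<^esub> (?z \<otimes>\<^bsub>AutT (Suc n)\<^esub> ?k \<otimes>\<^bsub>AutT (Suc n)\<^esub> inv\<^bsub>AutT (Suc n)\<^esub> ?x)"
    using gens kc G.inv_solve_right[of "?x \<otimes>\<^bsub>AutT (Suc n)\<^esub> ?y"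
        "?y \<otimes>\<^bsub>AutT (Suc n)\<^esub> (?z \<otimes>\<^bsub>AutT (Suc n)\<^esub> ?k)" ?x]
    by (simp add: G.m_assoc)
  then have "inv\<^bsub>AutT (Suc n)\<^esub> ?y \<otimes>\<^bsub>AutT (Suc n)\<^esub> ?x \<otimes>\<^bsub>AutT (Suc n)\<^esub> ?y =
      ?z \<otimes>\<^bsub>AutT (Suc n)\<^esub> ?k \<otimes>\<^bsub>AutT (Suc n)\<^esub> inv\<^bsub>AutT (Suc n)\<^esub> ?x"
    using gens kc by (intro G.conj_eqI) simp_all
  moreover have "?z \<otimes>\<^bsub>AutT (Suc n)\<^esub> ?k \<otimes>\<^bsub>AutT (Suc n)\<^esub> inv\<^bsub>AutT (Suc n)\<^esub> ?x \<in> grp_L (Suc n)"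
    by (intro L.m_closed L.m_inv_closed gen_x_in_grp_L gen_z_in_grp_L k)
  ultimately show ?thesis by metis
qed

text \<open>It suffices to conjugate the generators of \<open>L\<close>. A case split replaces
  induction: what enters from the level below is \<open>y'^2\<close> in \<open>L'\<close>, through
  \<open>gen_y_conj_gen_x\<close>.\<close>

lemma gen_y_normalises_grp_L:
  assumes "a \<in> grp_L n"
  shows "inv\<^bsub>AutT n\<^esub> gen_y n \<otimes>\<^bsub>AutT n\<^esub> a \<otimes>\<^bsub>AutT n\<^esub> gen_y n \<in> grp_L n"
proof (cases n)
  case 0
  then show ?thesis using assms monoid.inv_one[OF group.is_monoid[OF group_AutT[of 0]]] by (simp add: one_AutT)
next
  case (Suc m)
  interpret G: group "AutT (Suc m)" by (rule group_AutT)
  let ?y = "gen_y (Suc m)" and ?z = "gen_z (Suc m)"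
  note gens = gens_in_tree_auts[of m] gens_in_tree_auts[of "Suc m"]
  \<comment> \<open>\<open>y\<close> and \<open>z\<close> commute: the entries of \<open>z\<close>
    at the swapped letters agree, and the sections of \<open>y\<close> that occur are
    \<open>y'\<close> and \<open>x'\<close> against the same entries of \<open>z\<close>.\<close>
  have z: "inv\<^bsub>AutT (Suc m)\<^esub> ?y \<otimes>\<^bsub>AutT (Suc m)\<^esub> ?z \<otimes>\<^bsub>AutT (Suc m)\<^esub> ?y = ?z"
  proof (rule G.conj_eqI)
    show "?z \<otimes>\<^bsub>AutT (Suc m)\<^esub> ?y = ?y \<otimes>\<^bsub>AutT (Suc m)\<^esub> ?z"
      unfolding gen_y_Suc gen_z_Suc using gens by (simp add: wr_mult id_in_tree_auts)
  qed (use gens in simp_all)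
  \<comment> \<open>The section of \<open>y\<close> at \<open>0\<close> is \<open>id\<close>, so the
    entry \<open>d\<close> moves to coordinate \<open>1\<close> unchanged.\<close>
  have embed: "inv\<^bsub>AutT (Suc m)\<^esub> ?y \<otimes>\<^bsub>AutT (Suc m)\<^esub> tree_embed (Suc m) d \<otimes>\<^bsub>AutT (Suc m)\<^esub> ?y
      = wr (Suc m) (id, d, id) id" if "d \<in> tree_auts m" for d
  proof (rule G.conj_eqI)
    show "tree_embed (Suc m) d \<otimes>\<^bsub>AutT (Suc m)\<^esub> ?y =
        ?y \<otimes>\<^bsub>AutT (Suc m)\<^esub> wr (Suc m) (id, d, id) id"
      unfolding gen_y_Suc tree_embed_def using gens that by (simp add: wr_mult id_in_tree_auts)
  qed (use gens that in \<open>simp_all add: tree_embed_in_tree_auts wr_in_tree_auts id_in_tree_auts\<close>)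
  have "inv\<^bsub>AutT (Suc m)\<^esub> ?y \<otimes>\<^bsub>AutT (Suc m)\<^esub> s \<otimes>\<^bsub>AutT (Suc m)\<^esub> ?y \<in> grp_L (Suc m)"
    if "s \<in> {gen_x (Suc m), gen_z (Suc m)} \<union> tree_embed (Suc m) ` grp_L m" for s
  proof -
    have "wr (Suc m) (id, d, id) id \<in> grp_L (Suc m)" if "d \<in> grp_L m" for d
      using triples_subset_grp_L that id_in_grp_L unfolding triples_def by blast
    with that show ?thesis
      using gen_y_conj_gen_x z gen_z_in_grp_L embed grp_L_in_tree_auts by auto
  qed
  then show ?thesis
    using assms G.conj_generate_closed[OF grp_L_generators, of ?y a] gens
    unfolding Suc grp_L.simps by auto
qed

text \<open>Stability is checked on the generators of \<open>L\<close>: \<open>x\<close> needs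
  \<open>x'\<close> in \<open>L'\<close>, and \<open>z\<close> needs in addition that
  \<open>y'\<close> normalises \<open>L'\<close>.\<close>

lemma triples_normal: "triples n \<lhd> AutT (Suc n)\<lparr>carrier := grp_L (Suc n)\<rparr>"
proof -
  interpret G: group "AutT (Suc n)" by (rule group_AutT)
  interpret L: subgroup "grp_L n" "AutT n" by (rule grp_L_subgroup)
  interpret K: subgroup "triples n" "AutT (Suc n)" by (rule subgroup_triples)
  have stable: "inv\<^bsub>AutT (Suc n)\<^esub> s \<otimes>\<^bsub>AutT (Suc n)\<^esub> k \<otimes>\<^bsub>AutT (Suc n)\<^esub> s \<in> triples n"
    if s: "s \<in> {gen_x (Suc n), gen_z (Suc n)} \<union> tree_embed (Suc n) ` grp_L n"
      and k: "k \<in> triples n" for s k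
  proof -
    obtain a b c where abc: "k = wr (Suc n) (a, b, c) id" "a \<in> grp_L n" "b \<in> grp_L n" "c \<in> grp_L n"
      using k by (auto simp: triples_def)
    have x': "inv\<^bsub>AutT n\<^esub> gen_x n \<otimes>\<^bsub>AutT n\<^esub> d \<otimes>\<^bsub>AutT n\<^esub> gen_x n \<in> grp_L n" if "d \<in> grp_L n" for d
      using that gen_x_in_grp_L by (intro L.m_closed L.m_inv_closed)
    note carr = abc(2-4)[THEN grp_L_in_tree_auts]
    \<comment> \<open>Embedded generators are themselves triples, so they fall under closure of a
      subgroup.\<close>
    consider "s = gen_x (Suc n)" | "s = gen_z (Suc n)" | "s \<in> triples n"
      using s id_in_grp_L unfolding triples_def tree_embed_def by blast
    then show ?thesis
    proof cases
      case 1
      show ?thesis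
        unfolding 1 abc(1) conj_triple_x[OF carr] triples_def using abc x' by blast
    next
      case 2
      show ?thesis
        unfolding 2 abc(1) conj_triple_z[OF carr] triples_def
        using abc x' gen_y_normalises_grp_L by blast
    next
      case 3
      then show ?thesis using k by (intro K.m_closed K.m_inv_closed)
    qed
  qed
  have "finite (triples n)" using K.subset finite_tree_auts finite_subset by fastforce
  then show ?thesis
    using G.normal_in_generateI[OF _ subgroup_triples _ grp_L_generators stable]
      triples_subset_grp_L[of n] by (simp add: grp_L.simps(2))
qed

section \<open>The direct product and the normal closure\<close>

lemma tree_embed_image: "tree_embed (Suc n) ` grp_L n = (\<lambda>a. wr (Suc n) (a, id, id) id) ` grp_L n"
  by (simp add: tree_embed_def)

lemma axis_triples_mult:
  assumes "a \<in> grp_L n" "b \<in> grp_L n"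
  shows "wr (Suc n) (a, id, id) id \<otimes>\<^bsub>AutT (Suc n)\<^esub> wr (Suc n) (id, b, id) id
      \<otimes>\<^bsub>AutT (Suc n)\<^esub> wr (Suc n) (id, id, c) id = wr (Suc n) (a, b, c) id"
  using assms by (simp add: triples_mult id_in_tree_auts grp_L_in_tree_auts)

text \<open>This image serves both as the product set of the axes and as the range of the map that
  \<open>internal_direct3\<close> requires to be an isomorphism.\<close>

lemma image_axis_triples:
  "(\<lambda>(a, b, c). a \<otimes>\<^bsub>AutT (Suc n)\<^esub> b \<otimes>\<^bsub>AutT (Suc n)\<^esub> c) `
    ((\<lambda>a. wr (Suc n) (a, id, id) id) ` grp_L n \<times> (\<lambda>b. wr (Suc n) (id, b, id) id) ` grp_L n
      \<times> (\<lambda>c. wr (Suc n) (id, id, c) id) ` grp_L n) = triples n"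
  (is "?f ` (?A \<times> ?B \<times> ?C) = _")
proof
  show "?f ` (?A \<times> ?B \<times> ?C) \<subseteq> triples n"
  proof clarsimp
    fix a b c assume "a \<in> grp_L n" "b \<in> grp_L n" "c \<in> grp_L n"
    then show "wr (Suc n) (a, id, id) id \<otimes>\<^bsub>AutT (Suc n)\<^esub> wr (Suc n) (id, b, id) id
        \<otimes>\<^bsub>AutT (Suc n)\<^esub> wr (Suc n) (id, id, c) id \<in> triples n"
      by (simp add: axis_triples_mult triplesI)
  qed
  show "triples n \<subseteq> ?f ` (?A \<times> ?B \<times> ?C)"
  proof
    fix g assume "g \<in> triples n"
    then obtain a b c
      where g: "g = wr (Suc n) (a, b, c) id" "a \<in> grp_L n" "b \<in> grp_L n" "c \<in> grp_L n"
      by (auto simp: triples_def)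
    then have "g = ?f (wr (Suc n) (a, id, id) id, wr (Suc n) (id, b, id) id, wr (Suc n) (id, id, c) id)"
      by (simp add: axis_triples_mult)
    then show "g \<in> ?f ` (?A \<times> ?B \<times> ?C)" using g by blast
  qed
qed

lemma set_mult_triples:
  "(\<lambda>a. wr (Suc n) (a, id, id) id) ` grp_L n <#>\<^bsub>AutT (Suc n)\<^esub> (\<lambda>b. wr (Suc n) (id, b, id) id) ` grp_L n
    <#>\<^bsub>AutT (Suc n)\<^esub> (\<lambda>c. wr (Suc n) (id, id, c) id) ` grp_L n = triples n"
proof -
  have "A <#>\<^bsub>G\<^esub> B <#>\<^bsub>G\<^esub> C = (\<lambda>(a, b, c). a \<otimes>\<^bsub>G\<^esub> b \<otimes>\<^bsub>G\<^esub> c) ` (A \<times> B \<times> C)"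
    for A B C and G :: "(word \<Rightarrow> word) monoid"
    by (force simp: set_mult_def)
  then show ?thesis using image_axis_triples by simp
qed

lemma grp_H_eq_triples: "grp_H (Suc n) = triples n"
proof
  let ?A = "tree_embed (Suc n) ` grp_L n" and ?L = "AutT (Suc n)\<lparr>carrier := grp_L (Suc n)\<rparr>"
  interpret G: group "AutT (Suc n)" by (rule group_AutT)
  have "?A \<subseteq> triples n" using id_in_grp_L unfolding triples_def tree_embed_def by blast
  then show "grp_H (Suc n) \<subseteq> triples n"
    using triples_normal unfolding grp_H_def normal_closure_def by auto
  show "triples n \<subseteq> grp_H (Suc n)"
    unfolding grp_H_def normal_closure_def
  proof (intro Inter_greatest, clarsimp)
    fix N g assume N: "N \<lhd> ?L" "?A \<subseteq> N" and g: "g \<in> triples n"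
    \<comment> \<open>\<open>N\<close> is normal in the restricted group \<open>L\<close>; viewing
      it inside \<open>AutT (Suc n)\<close> lets products and inverses be taken in the ambient
      group.\<close>
    have sub: "subgroup N (AutT (Suc n))"
      using G.incl_subgroup[OF grp_L_subgroup normal_imp_subgroup[OF N(1)]] .
    interpret N: subgroup N "AutT (Suc n)" by (rule sub)
    have conj: "conj_set (AutT (Suc n)) ?A h \<subseteq> N" if h: "h \<in> grp_L (Suc n)" for h
    proof -
      have "inv\<^bsub>AutT (Suc n)\<^esub> h \<otimes>\<^bsub>AutT (Suc n)\<^esub> a \<otimes>\<^bsub>AutT (Suc n)\<^esub> h \<in> N" if "a \<in> N" for a
        using normal.inv_op_closed1[OF N(1), of h a] that h
          G.m_inv_consistent[OF grp_L_subgroup h] by simp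
      then show ?thesis using N(2) unfolding conj_set_def by blast
    qed
    have x: "gen_x (Suc n) \<in> grp_L (Suc n)" by (rule gen_x_in_grp_L)
    obtain a b c where abc: "a \<in> grp_L n" "b \<in> grp_L n" "c \<in> grp_L n"
      "g = wr (Suc n) (a, id, id) id \<otimes>\<^bsub>AutT (Suc n)\<^esub> wr (Suc n) (id, b, id) id
        \<otimes>\<^bsub>AutT (Suc n)\<^esub> wr (Suc n) (id, id, c) id"
      using g unfolding image_axis_triples[symmetric] by auto
    then have "wr (Suc n) (a, id, id) id \<in> N" "wr (Suc n) (id, b, id) id \<in> N"
      "wr (Suc n) (id, id, c) id \<in> N"
      using N(2)[unfolded tree_embed_image] conj[OF x, unfolded conj_set_embed]
        conj[OF gen_x_square_in_grp_L, unfolded conj_set_embed] by auto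
    with abc(4) show "g \<in> N" by (simp only: N.m_closed)
  qed
qed

text \<open>Elements on different axes commute because triples multiply coordinatewise, which gives
  the homomorphism; injectivity is the uniqueness of sections, \<open>wr_eq_iff\<close>.\<close>

lemma internal_direct3_triples:
  "internal_direct3 (AutT (Suc n)) ((\<lambda>a. wr (Suc n) (a, id, id) id) ` grp_L n)
    ((\<lambda>b. wr (Suc n) (id, b, id) id) ` grp_L n) ((\<lambda>c. wr (Suc n) (id, id, c) id) ` grp_L n)"
  (is "internal_direct3 ?G ?A ?B ?C")
proof -
  have triv: "subgroup {id} (AutT n)"
    using group.triv_subgroup[OF group_AutT[of n]] by (simp add: one_AutT)
  \<comment> \<open>Each axis is a set of triples with the trivial group in two coordinates.\<close>
  have "?A = {wr (Suc n) (a, b, c) id | a b c. a \<in> grp_L n \<and> b \<in> {id} \<and> c \<in> {id}}" by blast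
  then have A: "subgroup ?A ?G"
    using subgroup_wr_triples[OF grp_L_subgroup triv triv] by simp
  have "?B = {wr (Suc n) (a, b, c) id | a b c. a \<in> {id} \<and> b \<in> grp_L n \<and> c \<in> {id}}" by blast
  then have B: "subgroup ?B ?G"
    using subgroup_wr_triples[OF triv grp_L_subgroup triv] by simp
  have "?C = {wr (Suc n) (a, b, c) id | a b c. a \<in> {id} \<and> b \<in> {id} \<and> c \<in> grp_L n}" by blast
  then have C: "subgroup ?C ?G"
    using subgroup_wr_triples[OF triv triv grp_L_subgroup] by simp
  let ?f = "\<lambda>(a, b, c). a \<otimes>\<^bsub>?G\<^esub> b \<otimes>\<^bsub>?G\<^esub> c"
  have hom: "?f \<in> hom (?G\<lparr>carrier := ?A\<rparr> \<times>\<times> ?G\<lparr>carrier := ?B\<rparr> \<times>\<times> ?G\<lparr>carrier := ?C\<rparr>)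
      (?G\<lparr>carrier := triples n\<rparr>)"
    by (rule homI)
      (auto simp: DirProd_def triples_mult id_in_tree_auts grp_L_in_tree_auts triplesI)
  have inj: "inj_on ?f (?A \<times> ?B \<times> ?C)"
    by (rule inj_onI) (auto simp: axis_triples_mult grp_L_in_tree_auts wr_eq_iff)
  show ?thesis
    using A B C hom inj image_axis_triples
    by (simp add: internal_direct3_def set_mult_triples iso_def bij_betw_def DirProd_def)
qed

theorem theorem3p9:
  fixes n :: nat
  assumes "n \<ge> 1"
  shows "let G = AutT n;
             x = gen_x n;
             A = tree_embed n ` grp_L (n - 1);
             B = conj_set G A x;
             C = conj_set G A (x [^]\<^bsub>G\<^esub> (2::nat))
         in internal_direct3 G A B C \<and> grp_H n = A <#>\<^bsub>G\<^esub> B <#>\<^bsub>G\<^esub> C"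
proof -
  \<comment> \<open>For \<open>n >= 1\<close> the truncated difference \<open>n - 1\<close> is the
    true predecessor \<open>m\<close>.\<close>
  obtain m where n: "n = Suc m" using assms by (cases n) auto
  show ?thesis
    \<comment> \<open>The conjugates become the axes, and both the normal closure and the product
      set become \<open>triples m\<close>.\<close>
    unfolding n Let_def diff_Suc_1 conj_set_embed grp_H_eq_triples
    unfolding tree_embed_image set_mult_triples
    using internal_direct3_triples by simp
qed

end
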